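(* Let $\mathbb{T}$ be a time scale unbounded above, with shift operators $\delta_\pm$ associated with the initial point $t_0$, and let $t_0=h_0<h_1<\dots<h_r$ be constants in $\mathbb{T}$ such that $\delta_-(h_i,\cdot)$, $i=1,\dots,r$, are delay functions on $\mathbb{T}$ (so $\delta_-(h_0,t)=t$). Let $x$ be a function satisfying $$x^{\Delta}(t)\le -p(t)x(t)+\sum_{i=0}^{r}q_i(t)\,x^{\ell}(\delta_-(h_i,t)),\qquad t\in[t_0,\infty)_{\mathbb{T}},$$ where $\ell\in(0,1]$ is a constant and $p,q_0,\dots,q_r$ are continuous and bounded functions satisfying, for all $t\in[t_0,\infty)_{\mathbb{T}}$, $1-\widetilde{\mu}(t)p(t)\ge 0$, $q_i(t)\ge 0$ for $i=0,1,\dots,r-1$, and $q_r(t)>0$. Suppose that $$p(t)-\sum_{i=0}^{r}q_i(t)>0\quad\text{for all }t\in[t_0,\infty)_{\mathbb{T}}.$$ Then there exist a positively regressive function $\lambda:[t_0,\infty)_{\mathbb{T}}\to(-\infty,0)$ and a constant $K_0>1$ such that $$x(t)\le K_0\,e_{\lambda}(t,t_0)\quad\text{for all }t\in[t_0,\infty)_{\mathbb{T}}.$$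
   Context: Time scales. A time scale $\mathbb{T}$ is a nonempty closed subset of $\mathbb{R}$; $[a,b]_{\mathbb{T}}=[a,b]\cap\mathbb{T}$, and similarly for other intervals. $\sigma(t)=\inf\{s\in\mathbb{T}:s>t\}$ is the forward jump and $\mu(t)=\sigma(t)-t$. The delta derivative is $f^{\Delta}(t)=\lim_{s\to t,\,s\ne\sigma(t)}\frac{f(\sigma(t))-f(s)}{\sigma(t)-s}$. A function is rd-continuous if it is continuous at right-dense points ($\sigma(t)=t$) and has finite left-sided limits at left-dense points. An rd-continuous $\varphi$ is positively regressive ($\varphi\in\mathcal{R}^+$) if $1+\mu(t)\varphi(t)>0$ for all $t$. For such $\varphi$, $e_{\varphi}(t,s)=\exp\left(\int_s^t\zeta_{\mu(r)}(\varphi(r))\,\Delta r\right)$, with $\zeta_{\mu}(z)=\frac{1}{\mu}\log(1+\mu z)$ if $\mu>0$ and $\zeta_0(z)=z$; equivalently $y=e_\varphi(\cdot,s)$ solves $y^\Delta=\varphi(t)y$, $y(s)=1$. Shift operators. Let $\mathbb{T}^*\subset\mathbb{T}$ be nonempty with $t_0\in\mathbb{T}^*$. Operators $\delta_\pm:[t_0,\infty)_{\mathbb{T}}\times\mathbb{T}^*\to\mathbb{T}^*$, with domains $\mathcal{D}_\pm=\{(s,t)\in[t_0,\infty)_{\mathbb{T}}\times\mathbb{T}^*:\delta_\pm(s,t)\in\mathbb{T}^*\}$, are the backward ($\delta_-$) and forward ($\delta_+$) shift operators associated with the initial point $t_0$ if: P.1: if $(T_0,t),(T_0,u)\in\mathcal{D}_\pm$,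 then $T_0\le t<u$ implies $\delta_\pm(T_0,t)<\delta_\pm(T_0,u)$ ($\delta_\pm$ are strictly increasing in the second argument); P.2: if $(T_1,u),(T_2,u)\in\mathcal{D}_-$ with $T_1<T_2$ then $\delta_-(T_1,u)>\delta_-(T_2,u)$; if $(T_1,u),(T_2,u)\in\mathcal{D}_+$ with $T_1<T_2$ then $\delta_+(T_1,u)<\delta_+(T_2,u)$; P.3: if $t\in[t_0,\infty)_{\mathbb{T}}$ then $(t,t_0)\in\mathcal{D}_+$ and $\delta_+(t,t_0)=t$; if $t\in\mathbb{T}^*$ then $(t_0,t)\in\mathcal{D}_+$ and $\delta_+(t_0,t)=t$; P.4: if $(s,t)\in\mathcal{D}_\pm$ then $(s,\delta_\pm(s,t))\in\mathcal{D}_\mp$ and $\delta_\mp(s,\delta_\pm(s,t))=t$; P.5: if $(s,t)\in\mathcal{D}_\pm$ and $(u,\delta_\pm(s,t))\in\mathcal{D}_\mp$ then $(s,\delta_\mp(u,t))\in\mathcal{D}_\pm$ and $\delta_\mp(u,\delta_\pm(s,t))=\delta_\pm(s,\delta_\mp(u,t))$. Delay functions ($\mathbb{T}$ and $\mathbb{T}^*$ unbounded above). For $h\in(t_0,\infty)_{\mathbb{T}}$ with $(h,t)\in\mathcal{D}_\pm$ for all $t\in[t_0,\infty)_{\mathbb{T}}$, $\delta_-(h,\cdot)$ is a delay function on $\mathbb{T}$ if it is $\Delta$-differentiable with rd-continuous derivative and maps $[t_0,\infty)_{\mathbb{T}}$ onto $[\delta_-(h,t_0),\infty)_{\mathbb{T}}$.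 Notation. $\widetilde{\mu}(t)=\sup_{s\in[\delta_-(h_r,t_0),t]_{\mathbb{T}}}\mu(s)$ for $t\in[t_0,\infty)_{\mathbb{T}}$. The function $x$ is real-valued on $[\delta_-(h_r,t_0),\infty)_{\mathbb{T}}$, and $x^\ell(s)=(x(s))^\ell$. *)

theory Defs
  imports "HOL-Analysis.Analysis"
begin

definition time_scale :: "real set \<Rightarrow> bool" where
  "time_scale T \<longleftrightarrow> closed T \<and> T \<noteq> {}"

text \<open>The second branch is the usual convention that the infimum of the empty set is \<open>sup T\<close>;
  it only matters at a maximum of \<open>T\<close>.\<close>

definition forward_jump :: "real set \<Rightarrow> real \<Rightarrow> real" where
  "forward_jump T t = (if \<exists>s\<in>T. t < s then Inf {s \<in> T. t < s} else t)"

definition graininess :: "real set \<Rightarrow> real \<Rightarrow> real" where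
  "graininess T t = forward_jump T t - t"

definition right_dense :: "real set \<Rightarrow> real \<Rightarrow> bool" where
  "right_dense T t \<longleftrightarrow> forward_jump T t = t"

definition left_dense :: "real set \<Rightarrow> real \<Rightarrow> bool" where
  "left_dense T t \<longleftrightarrow> t islimpt (T \<inter> {..<t})"

text \<open>The limit defining the delta derivative excludes \<open>s = \<sigma>(t)\<close> but not \<open>s = t\<close>: at a
  right-scattered point the quotient is defined at \<open>s = t\<close>, and it is the only admissible \<open>s\<close> near an
  isolated \<open>t\<close>. Hence the filter below instead of \<open>at t within T\<close>, with which it agrees when
  \<open>\<sigma>(t) = t\<close>.\<close>

definition has_delta_derivative ::
    "real set \<Rightarrow> (real \<Rightarrow> real) \<Rightarrow> real \<Rightarrow> real \<Rightarrow> bool" where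
  "has_delta_derivative T f D t \<longleftrightarrow>
     ((\<lambda>s. (f (forward_jump T t) - f s) / (forward_jump T t - s)) \<longlongrightarrow> D)
       (inf (nhds t) (principal (T - {forward_jump T t})))"

definition rd_continuous :: "real set \<Rightarrow> (real \<Rightarrow> real) \<Rightarrow> bool" where
  "rd_continuous T f \<longleftrightarrow>
     (\<forall>t\<in>T. (right_dense T t \<longrightarrow> continuous (at t within T) f) \<and>
            (left_dense T t \<longrightarrow> (\<exists>L. (f \<longlongrightarrow> L) (at t within (T \<inter> {..<t})))))"

definition positively_regressive :: "real set \<Rightarrow> (real \<Rightarrow> real) \<Rightarrow> bool" where
  "positively_regressive T \<phi> \<longleftrightarrow> rd_continuous T \<phi> \<and> (\<forall>t\<in>T. 1 + graininess T t * \<phi> t > 0)"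

text \<open>The Cauchy delta integral, \<open>F(b) - F(a)\<close> for an antiderivative \<open>F\<close>. Antiderivatives on a time
  scale are unique up to a constant, and every rd-continuous function has one.\<close>

definition delta_integral :: "real set \<Rightarrow> (real \<Rightarrow> real) \<Rightarrow> real \<Rightarrow> real \<Rightarrow> real" where
  "delta_integral T f a b =
     (THE I. \<exists>F. (\<forall>t\<in>T. has_delta_derivative T F (f t) t) \<and> I = F b - F a)"

definition cylinder :: "real \<Rightarrow> real \<Rightarrow> real" where
  "cylinder m z = (if m > 0 then ln (1 + m * z) / m else z)"

definition delta_exp :: "real set \<Rightarrow> (real \<Rightarrow> real) \<Rightarrow> real \<Rightarrow> real \<Rightarrow> real" where
  "delta_exp T \<phi> t s = exp (delta_integral T (\<lambda>r. cylinder (graininess T r) (\<phi> r)) s t)"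

text \<open>Shift operators are partial; they are represented by total functions, where a value in \<open>Ts\<close>
  at an admissible pair \<open>(s, t)\<close> signals definedness. \<open>Ts\<close> stands for the subset of the time scale
  \<open>T\<close> on which the shifts act.\<close>

definition shift_dom ::
    "real set \<Rightarrow> real set \<Rightarrow> real \<Rightarrow> (real \<Rightarrow> real \<Rightarrow> real) \<Rightarrow> (real \<times> real) set" where
  "shift_dom T Ts t0 \<delta> = {(s, t). s \<in> T \<inter> {t0..} \<and> t \<in> Ts \<and> \<delta> s t \<in> Ts}"

definition shift_mono ::
    "real set \<Rightarrow> real set \<Rightarrow> real \<Rightarrow> (real \<Rightarrow> real \<Rightarrow> real) \<Rightarrow> bool" where
  "shift_mono T Ts t0 \<delta> \<longleftrightarrow>
     (\<forall>s t u. (s, t) \<in> shift_dom T Ts t0 \<delta> \<and> (s, u) \<in> shift_dom T Ts t0 \<delta> \<and> s \<le> t \<and> t < u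
        \<longrightarrow> \<delta> s t < \<delta> s u)"

definition shift_inverse ::
    "real set \<Rightarrow> real set \<Rightarrow> real \<Rightarrow> (real \<Rightarrow> real \<Rightarrow> real) \<Rightarrow> (real \<Rightarrow> real \<Rightarrow> real) \<Rightarrow> bool" where
  "shift_inverse T Ts t0 \<delta> \<delta>' \<longleftrightarrow>
     (\<forall>s t. (s, t) \<in> shift_dom T Ts t0 \<delta> \<longrightarrow>
        (s, \<delta> s t) \<in> shift_dom T Ts t0 \<delta>' \<and> \<delta>' s (\<delta> s t) = t)"

definition shift_commute ::
    "real set \<Rightarrow> real set \<Rightarrow> real \<Rightarrow> (real \<Rightarrow> real \<Rightarrow> real) \<Rightarrow> (real \<Rightarrow> real \<Rightarrow> real) \<Rightarrow> bool" where
  "shift_commute T Ts t0 \<delta> \<delta>' \<longleftrightarrow>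
     (\<forall>s t u. (s, t) \<in> shift_dom T Ts t0 \<delta> \<and> (u, \<delta> s t) \<in> shift_dom T Ts t0 \<delta>' \<longrightarrow>
        (s, \<delta>' u t) \<in> shift_dom T Ts t0 \<delta> \<and> \<delta>' u (\<delta> s t) = \<delta> s (\<delta>' u t))"

definition shift_operators ::
    "real set \<Rightarrow> real set \<Rightarrow> real \<Rightarrow> (real \<Rightarrow> real \<Rightarrow> real) \<Rightarrow> (real \<Rightarrow> real \<Rightarrow> real) \<Rightarrow> bool" where
  "shift_operators T Ts t0 \<delta>m \<delta>p \<longleftrightarrow>
     Ts \<subseteq> T \<and> t0 \<in> Ts \<and>
     shift_mono T Ts t0 \<delta>m \<and> shift_mono T Ts t0 \<delta>p \<and>
     (\<forall>S1 S2 u. (S1, u) \<in> shift_dom T Ts t0 \<delta>m \<and> (S2, u) \<in> shift_dom T Ts t0 \<delta>m \<and> S1 < S2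
        \<longrightarrow> \<delta>m S1 u > \<delta>m S2 u) \<and>
     (\<forall>S1 S2 u. (S1, u) \<in> shift_dom T Ts t0 \<delta>p \<and> (S2, u) \<in> shift_dom T Ts t0 \<delta>p \<and> S1 < S2
        \<longrightarrow> \<delta>p S1 u < \<delta>p S2 u) \<and>
     (\<forall>t \<in> T \<inter> {t0..}. (t, t0) \<in> shift_dom T Ts t0 \<delta>p \<and> \<delta>p t t0 = t) \<and>
     (\<forall>t \<in> Ts. (t0, t) \<in> shift_dom T Ts t0 \<delta>p \<and> \<delta>p t0 t = t) \<and>
     shift_inverse T Ts t0 \<delta>m \<delta>p \<and> shift_inverse T Ts t0 \<delta>p \<delta>m \<and>
     shift_commute T Ts t0 \<delta>m \<delta>p \<and> shift_commute T Ts t0 \<delta>p \<delta>m"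

definition delay_function ::
    "real set \<Rightarrow> real set \<Rightarrow> real \<Rightarrow> (real \<Rightarrow> real \<Rightarrow> real) \<Rightarrow> (real \<Rightarrow> real \<Rightarrow> real) \<Rightarrow> real \<Rightarrow> bool"
  where
  "delay_function T Ts t0 \<delta>m \<delta>p h \<longleftrightarrow>
     h \<in> T \<and> t0 < h \<and>
     (\<forall>t \<in> T \<inter> {t0..}. (h, t) \<in> shift_dom T Ts t0 \<delta>m \<and> (h, t) \<in> shift_dom T Ts t0 \<delta>p) \<and>
     (\<exists>d. rd_continuous (T \<inter> {t0..}) d \<and>
          (\<forall>t \<in> T \<inter> {t0..}. has_delta_derivative (T \<inter> {t0..}) (\<delta>m h) (d t) t)) \<and>
     \<delta>m h ` (T \<inter> {t0..}) = T \<inter> {\<delta>m h t0..}"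

text \<open>The supremum of the graininess over \<open>[a, t]\<close> in \<open>T\<close>.\<close>

definition sup_graininess :: "real set \<Rightarrow> real \<Rightarrow> real \<Rightarrow> real" where
  "sup_graininess T a t = (SUP s \<in> T \<inter> {a..t}. graininess T s)"

text \<open>A real power \<open>y\<^sup>l\<close>, for \<open>l > 0\<close>, of a real base that may be negative. For \<open>y \<ge> 0\<close> it is the
  ordinary power, for \<open>l = 1\<close> it is \<open>y\<close>, and for a quotient \<open>l\<close> of odd integers it is the real
  root. It differs from \<open>powr\<close>, which does not give \<open>y powr 1 = y\<close> for negative \<open>y\<close>.\<close>

definition real_pow :: "real \<Rightarrow> real \<Rightarrow> real" where
  "real_pow y l = (if 0 \<le> y then y powr l else - ((- y) powr l))"

end

theory Submission
  imports Defs
begin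

text \<open>
  Let \<open>Q = \<Sum>q\<^sub>i\<close>. For a constant \<open>K \<ge> 1\<close> the power satisfies \<open>K\<^sup>l \<le> K\<close>, so \<open>p > Q\<close> says that \<open>K\<close> is a strict
  supersolution of the delay equation. The estimate only asks for a majorant that is a constant
  multiple of an exponential with negative exponent, that is, for a positive function with negative
  logarithmic derivative. It is therefore enough to perturb the constant to \<open>y = K (1 + z)\<close> with \<open>z\<close>
  positive, strictly decreasing, and so small that \<open>y\<close> is still a strict supersolution; then
  \<open>\<lambda> = y\<^sup>\<Delta> / y\<close> and \<open>K\<^sub>0 = y(t\<^sub>0)\<close>.

  The margin \<open>p - Q\<close> may tend to \<open>0\<close>, so \<open>z\<close> has to decay faster than the margin, and at the delayed
  arguments. Delays tend to infinity (\<open>delay_sublevel_bdd\<close>), hence the value of \<open>z\<close> at \<open>s\<close> is restricted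
  by the margin on a bounded set of times only, where it has a positive minimum
  (\<open>antimono_minorant\<close>). The resulting decreasing bound is smoothed by averaging (\<open>C1_minorant\<close>), and a
  \<open>C\<^sup>1\<close> function on the line restricts to a delta differentiable function with rd-continuous derivative
  (\<open>has_delta_derivative_of_C1\<close>). Its logarithmic derivative is a positively regressive exponent
  with exponential \<open>y(t) / y(t\<^sub>0)\<close> (\<open>delta_exp_log_derivative\<close>).

  That \<open>x \<le> y\<close> is a comparison by induction along the time scale (\<open>delta_comparison\<close>), in which
  \<open>1 - \<mu> p \<ge> 0\<close> carries the inequality across gaps. The comparison starts at a time after which all
  delayed arguments lie in \<open>[t\<^sub>0, \<infinity>)\<close>; up to that time \<open>x\<close> is continuous, hence bounded, and \<open>K\<close> is chosen
  above it.
\<close>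

section \<open>Forward jumps and induction on a time scale\<close>

lemma forward_jump_mem:
  assumes "closed S" "\<not> bdd_above S"
  shows "forward_jump S t \<in> S"
proof -
  have ex: "\<exists>s\<in>S. t < s" using assms(2) unfolding bdd_above_def by (meson not_le)
  have "Inf {s \<in> S. t < s} \<in> closure {s \<in> S. t < s}"
    using ex by (intro closure_contains_Inf) (auto intro: bdd_belowI[of _ t] less_imp_le)
  also have "\<dots> \<subseteq> S" by (rule closure_minimal) (use assms in auto)
  finally show ?thesis using ex by (simp add: forward_jump_def)
qed

lemma forward_jump_ge: "t \<le> forward_jump S t"
  unfolding forward_jump_def by (auto intro!: cInf_greatest)

lemma forward_jump_le:
  assumes "u \<in> S" "t < u"
  shows "forward_jump S t \<le> u"
proof -
  have "Inf {s \<in> S. t < s} \<le> u"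
    using assms by (intro cInf_lower bdd_belowI[of _ t]) auto
  with assms show ?thesis by (auto simp: forward_jump_def)
qed

lemma right_dense_point_near:
  assumes "\<not> bdd_above S" "right_dense S t" "0 < e"
  shows "\<exists>u\<in>S. t < u \<and> u < t + e"
proof -
  have ex: "\<exists>s\<in>S. t < s" using assms(1) unfolding bdd_above_def by (meson not_le)
  then have "Inf {s \<in> S. t < s} < t + e"
    using assms by (auto simp: right_dense_def forward_jump_def)
  then show ?thesis
    using ex cInf_lessD[of "{s \<in> S. t < s}" "t + e"] by auto
qed

lemma right_scattered_iff: "\<not> right_dense S t \<longleftrightarrow> t < forward_jump S t"
  using forward_jump_ge[of t S] by (auto simp: right_dense_def)

text \<open>Consider the infimum of the points from \<open>a\<close> on at which \<open>P\<close> fails. It belongs to \<open>S\<close>, and whatever its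
  type, one of the three steps rules it out: a right-scattered point propagates \<open>P\<close> to its jump, a
  right-dense point to a right neighbourhood, and a left-dense point inherits \<open>P\<close> as a limit.\<close>

lemma time_scale_induct [consumes 4, case_names base scattered right_dense left_dense]:
  fixes S :: "real set"
  assumes S: "closed S" "\<not> bdd_above S" and "a \<in> S" and "t \<in> S \<inter> {a..}"
    and base: "P a"
    and scattered: "\<And>t. \<lbrakk>t \<in> S; a \<le> t; t < forward_jump S t; \<And>s. s \<in> S \<Longrightarrow> a \<le> s \<Longrightarrow> s \<le> t \<Longrightarrow> P s\<rbrakk>
        \<Longrightarrow> P (forward_jump S t)"
    and rdense: "\<And>t. \<lbrakk>t \<in> S; a \<le> t; right_dense S t; \<And>s. s \<in> S \<Longrightarrow> a \<le> s \<Longrightarrow> s \<le> t \<Longrightarrow> P s\<rbrakk>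
        \<Longrightarrow> \<exists>e>0. \<forall>u\<in>S. t < u \<longrightarrow> u < t + e \<longrightarrow> P u"
    and ldense: "\<And>t. \<lbrakk>t \<in> S; a < t; left_dense S t; \<And>s. s \<in> S \<Longrightarrow> a \<le> s \<Longrightarrow> s < t \<Longrightarrow> P s\<rbrakk>
        \<Longrightarrow> P t"
  shows "P t"
proof (rule ccontr)
  assume "\<not> P t"
  define B where "B = {t \<in> S. a \<le> t \<and> \<not> P t}"
  define s where "s = Inf B"
  have B: "B \<noteq> {}" "bdd_below B"
    using \<open>\<not> P t\<close> assms(4) by (auto simp: B_def intro: bdd_belowI[of _ a])
  have "s \<in> closure B" unfolding s_def using B by (rule closure_contains_Inf)
  also have "closure B \<subseteq> S \<inter> {a..}"
    by (rule closure_minimal) (use S in \<open>auto simp: B_def\<close>)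
  finally have s: "s \<in> S" "a \<le> s" by auto
  have below: "P u" if "u \<in> S" "a \<le> u" "u < s" for u
    using that B cInf_lower[of u B] by (force simp: s_def B_def)
  have above: "s \<le> b" if "b \<in> B" for b
    unfolding s_def using that B by (intro cInf_lower)
  show False
  proof (cases "P s")
    case True
    then have upto: "P u" if "u \<in> S" "a \<le> u" "u \<le> s" for u
      using that below by (cases "u = s") auto
    have "\<exists>m>s. \<forall>b\<in>B. m \<le> b"
    proof (cases "right_dense S s")
      case True
      obtain e where e: "e > 0" "\<forall>u\<in>S. s < u \<longrightarrow> u < s + e \<longrightarrow> P u"
        using rdense[OF s True upto] by blast
      have "s + e \<le> b" if "b \<in> B" for b
        using e above[OF that] that \<open>P s\<close> by (cases "b = s") (force simp: B_def)+
      with e show ?thesis by (intro exI[of _ "s + e"]) auto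
    next
      case False
      then have j: "s < forward_jump S s" by (simp add: right_scattered_iff)
      have "forward_jump S s \<le> b" if "b \<in> B" for b
        using above[OF that] that \<open>P s\<close> by (cases "b = s") (auto simp: B_def intro!: forward_jump_le)
      with j show ?thesis by blast
    qed
    then show False using B(1) cInf_greatest[of B] unfolding s_def by (meson not_le)
  next
    case False
    then have "a < s" using base s by (cases "a = s") auto
    with False s below ldense have "\<not> left_dense S s" by blast
    \<comment> \<open>Since \<open>s\<close> is left-scattered, it is the jump of its predecessor \<open>v\<close>, which is covered by the scattered step.\<close>
    then obtain e where e: "e > 0" "\<And>u. u \<in> S \<Longrightarrow> u < s \<Longrightarrow> u \<le> s - e"
      unfolding left_dense_def islimpt_approachable by (force simp: dist_real_def)
    define v where "v = Sup (S \<inter> {a..s - e})"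
    have "v \<in> S \<inter> {a..s - e}"
      unfolding v_def using \<open>a \<in> S\<close> \<open>a < s\<close> e S
      by (intro closed_contains_Sup) (auto intro: closed_Int)
    moreover have top: "u \<le> v" if "u \<in> S" "u < s" for u
      using that e(2)[OF that] \<open>v \<in> _\<close> unfolding v_def
      by (cases "a \<le> u") (auto intro!: cSup_upper bdd_aboveI[of _ "s - e"])
    ultimately have v: "v \<in> S" "a \<le> v" "v < s" using e by auto
    have "\<not> right_dense S v"
      using right_dense_point_near[OF S(2), of v "s - v"] top v by force
    then have "v < forward_jump S v" by (simp add: right_scattered_iff)
    then have "forward_jump S v = s"
      using forward_jump_le[of s S v] s v top[OF forward_jump_mem[OF S, of v]] by force
    then have "P s" using scattered[of v] v below by auto
    with False show False by simp
  qed
qed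

section \<open>Delta derivatives\<close>

lemma has_delta_derivative_right_dense_iff:
  assumes "right_dense S t"
  shows "has_delta_derivative S f D t \<longleftrightarrow> (f has_real_derivative D) (at t within S)"
proof -
  have "inf (nhds t) (principal (S - {t})) = at t within S"
    by (simp add: at_within_def)
  moreover have "(f t - f s) / (t - s) = (f s - f t) / (s - t)" for s
    by (metis minus_diff_eq minus_divide_divide)
  ultimately show ?thesis
    using assms by (simp add: has_delta_derivative_def right_dense_def has_field_derivative_iff)
qed

text \<open>At a right-scattered point the filter contains \<open>t\<close> itself, so a limit of the difference quotient
  is forced to be its value at \<open>t\<close>, and the quotient converges exactly when \<open>f\<close> is continuous there.\<close>

lemma has_delta_derivative_right_scattered_iff:
  assumes "t \<in> S" "t < forward_jump S t"
  shows "has_delta_derivative S f D t \<longleftrightarrow>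
    continuous (at t within S) f \<and> D = (f (forward_jump S t) - f t) / (forward_jump S t - t)"
proof -
  define j where "j = forward_jump S t"
  define G where "G = inf (nhds t) (principal S)"
  have tj: "t < j" using assms by (simp add: j_def)
  have ev: "eventually P G \<longleftrightarrow> (\<forall>\<^sub>F s in nhds t. s \<in> S \<longrightarrow> P s)" for P
    by (simp add: G_def eventually_inf_principal)
  have away: "\<forall>\<^sub>F s in nhds t. s < j" using tj by (intro eventually_nhds_in_open[of "{..<j}", simplified]) auto
  \<comment> \<open>Points close to \<open>t\<close> differ from \<open>j\<close>, so the filter of the delta derivative is that of continuity at \<open>t\<close>.\<close>
  have G: "G = inf (nhds t) (principal (S - {j}))"
    by (rule filter_eqI, unfold ev eventually_inf_principal)
       (rule eventually_subst, use away in \<open>auto elim: eventually_mono\<close>)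
  have at_t: "P t" if "eventually P G" for P
    using that assms(1) eventually_nhds_x_imp_x by (fastforce simp: ev)
  have cont: "continuous (at t within S) f \<longleftrightarrow> (f \<longlongrightarrow> f t) G"
    unfolding continuous_within G_def by (rule tendsto_at_within_iff_tendsto_nhds)
  have id: "((\<lambda>s. s) \<longlongrightarrow> t) G" unfolding G_def by (simp add: filterlim_def le_infI1)
  show ?thesis
    unfolding has_delta_derivative_def G[symmetric] j_def[symmetric] cont
  proof safe
    assume D: "((\<lambda>s. (f j - f s) / (j - s)) \<longlongrightarrow> D) G"
    have "((\<lambda>s. f j - (j - s) * ((f j - f s) / (j - s))) \<longlongrightarrow> f j - (j - t) * D) G"
      by (intro tendsto_intros D id)
    then have lim: "(f \<longlongrightarrow> f j - (j - t) * D) G"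
      by (rule Lim_transform_eventually) (use away in \<open>auto simp: ev elim: eventually_mono\<close>)
    have "f t = f j - (j - t) * D"
    proof (rule ccontr)
      assume "f t \<noteq> f j - (j - t) * D"
      then have "\<forall>\<^sub>F s in G. f s \<noteq> f t" using lim by (intro tendsto_imp_eventually_ne) auto
      then show False using at_t by blast
    qed
    then show "(f \<longlongrightarrow> f t) G" "D = (f j - f t) / (j - t)"
      using lim tj by (simp, simp add: field_simps)
  next
    assume "(f \<longlongrightarrow> f t) G"
    then show "((\<lambda>s. (f j - f s) / (j - s)) \<longlongrightarrow> (f j - f t) / (j - t)) G"
      using tj by (intro tendsto_intros id) auto
  qed
qed

lemma has_delta_derivative_continuous:
  assumes "has_delta_derivative S f D t" "t \<in> S"
  shows "continuous (at t within S) f"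
proof (cases "right_dense S t")
  case True
  then show ?thesis
    using assms has_delta_derivative_right_dense_iff by (metis DERIV_continuous)
next
  case False
  then show ?thesis
    using assms has_delta_derivative_right_scattered_iff right_scattered_iff by blast
qed

lemma has_delta_derivative_jump:
  assumes "has_delta_derivative S f D t" "t \<in> S"
  shows "f (forward_jump S t) = f t + graininess S t * D"
proof (cases "right_dense S t")
  case True
  then show ?thesis by (simp add: right_dense_def graininess_def)
next
  case False
  then have "t < forward_jump S t" by (simp add: right_scattered_iff)
  then show ?thesis
    using assms has_delta_derivative_right_scattered_iff[of t S f D] by (simp add: graininess_def)
qed

lemma has_delta_derivative_diff:
  assumes "has_delta_derivative S f D t" "has_delta_derivative S g E t"
  shows "has_delta_derivative S (\<lambda>s. f s - g s) (D - E) t"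
  using tendsto_diff[OF assms[unfolded has_delta_derivative_def]]
  unfolding has_delta_derivative_def diff_divide_distrib[symmetric] by (simp add: algebra_simps)

text \<open>The mean value inequality: for every \<open>e > 0\<close> the bound \<open>\<bar>f t - f a\<bar> \<le> e * (t - a)\<close> propagates by
  induction along the time scale. This makes antiderivatives unique up to a constant, so that the
  description defining the delta integral has the expected value.\<close>

lemma delta_derivative_zero_imp_constant:
  assumes S: "closed S" "\<not> bdd_above S"
    and f: "\<And>t. t \<in> S \<Longrightarrow> has_delta_derivative S f 0 t"
    and "a \<in> S" "b \<in> S"
  shows "f a = f b"
  using \<open>a \<in> S\<close> \<open>b \<in> S\<close>
proof (induction a b rule: linorder_wlog)
  case (le a b)
  have bound: "\<bar>f b - f a\<bar> \<le> e * (b - a)" if "e > 0" for e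
  proof -
    have "b \<in> S \<inter> {a..}" using le by auto
    with S \<open>a \<in> S\<close> show ?thesis
    proof (induction rule: time_scale_induct)
      case base
      show ?case by simp
    next
      case (scattered t)
      have "\<bar>f (forward_jump S t) - f a\<bar> \<le> e * (t - a)"
        using has_delta_derivative_jump[OF f[of t]] scattered(1,2) scattered(4)[of t] by simp
      also have "\<dots> \<le> e * (forward_jump S t - a)"
        using \<open>e > 0\<close> scattered(3) by (intro mult_left_mono) auto
      finally show ?case .
    next
      case (right_dense t)
      have "(f has_derivative (*) 0) (at t within S)"
        using f[OF \<open>t \<in> S\<close>] has_delta_derivative_right_dense_iff[OF \<open>right_dense S t\<close>]
        by (simp add: has_field_derivative_def)
      then obtain d where d: "d > 0"
        "\<And>u. u \<in> S \<Longrightarrow> \<bar>u - t\<bar> < d \<Longrightarrow> \<bar>f u - f t\<bar> \<le> e * \<bar>u - t\<bar>"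
        using \<open>e > 0\<close> unfolding has_derivative_within_alt by (auto simp: real_norm_def)
      have "\<bar>f u - f a\<bar> \<le> e * (u - a)" if "u \<in> S" "t < u" "u < t + d" for u
        using d(2)[of u] that right_dense(4)[of t] right_dense(1,2) by (simp add: algebra_simps)
      with \<open>d > 0\<close> show ?case by blast
    next
      case (left_dense t)
      have "(f \<longlongrightarrow> f t) (at t within S \<inter> {..<t})"
        using has_delta_derivative_continuous[OF f[OF \<open>t \<in> S\<close>] \<open>t \<in> S\<close>]
        by (meson continuous_within inf_le1 tendsto_within_subset)
      then have "((\<lambda>u. \<bar>f u - f a\<bar>) \<longlongrightarrow> \<bar>f t - f a\<bar>) (at t within S \<inter> {..<t})"
        by (intro tendsto_intros)
      moreover have "((\<lambda>u. e * (u - a)) \<longlongrightarrow> e * (t - a)) (at t within S \<inter> {..<t})"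
        by (intro tendsto_intros)
      moreover have "\<forall>\<^sub>F u in at t within S \<inter> {..<t}. \<bar>f u - f a\<bar> \<le> e * (u - a)"
        unfolding eventually_at using left_dense
        by (intro exI[of _ "t - a"]) (auto simp: dist_real_def)
      moreover have "at t within S \<inter> {..<t} \<noteq> bot"
        using \<open>left_dense S t\<close> by (simp add: left_dense_def trivial_limit_within)
      ultimately show ?case by (intro tendsto_le[where f="\<lambda>u. e * (u - a)"])
    qed
  qed
  show ?case
  proof (cases "a = b")
    case False
    with le have "a < b" by simp
    then have "\<bar>f b - f a\<bar> \<le> 0 + e" if "e > 0" for e
      using bound[of "e / (b - a)"] that by simp
    then show ?thesis using field_le_epsilon[of "\<bar>f b - f a\<bar>" 0] by force
  qed simp
qed simp

section \<open>The delta exponential of a logarithmic derivative\<close>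

lemma delta_integral_eq:
  assumes S: "closed S" "\<not> bdd_above S"
    and F: "\<And>t. t \<in> S \<Longrightarrow> has_delta_derivative S F (f t) t"
    and ab: "a \<in> S" "b \<in> S"
  shows "delta_integral S f a b = F b - F a"
  unfolding delta_integral_def
proof (rule the_equality)
  show "\<exists>G. (\<forall>t\<in>S. has_delta_derivative S G (f t) t) \<and> F b - F a = G b - G a"
    using F by blast
next
  fix I
  assume "\<exists>G. (\<forall>t\<in>S. has_delta_derivative S G (f t) t) \<and> I = G b - G a"
  then obtain G where G: "\<And>t. t \<in> S \<Longrightarrow> has_delta_derivative S G (f t) t" "I = G b - G a"
    by blast
  have "has_delta_derivative S (\<lambda>s. G s - F s) 0 t" if "t \<in> S" for t
    using has_delta_derivative_diff[OF G(1) F, OF that that] by simp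
  from delta_derivative_zero_imp_constant[OF S this ab] G(2) show "I = F b - F a" by simp
qed

text \<open>The cylinder transformation is exactly what turns a logarithmic derivative into the delta
  derivative of the logarithm: at a right-scattered point \<open>1 + \<mu> D / y = y(\<sigma>) / y\<close>. Hence every positive
  delta differentiable \<open>y\<close> is a multiple of the exponential of its logarithmic derivative, and an
  exponential with prescribed behaviour can be found by choosing \<open>y\<close> instead of its exponent.\<close>

lemma has_delta_derivative_ln:
  assumes y: "has_delta_derivative S y D t" and "t \<in> S"
    and pos: "y t > 0" "y (forward_jump S t) > 0"
  shows "has_delta_derivative S (\<lambda>s. ln (y s)) (cylinder (graininess S t) (D / y t)) t"
proof (cases "right_dense S t")
  case True
  then have "(y has_real_derivative D) (at t within S)"
    using y by (simp add: has_delta_derivative_right_dense_iff)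
  then have "((\<lambda>s. ln (y s)) has_real_derivative (D / y t)) (at t within S)"
    using pos by (auto intro!: derivative_eq_intros)
  then show ?thesis
    using True by (simp add: has_delta_derivative_right_dense_iff cylinder_def graininess_def right_dense_def)
next
  case False
  then have j: "t < forward_jump S t" by (simp add: right_scattered_iff)
  have "1 + graininess S t * (D / y t) = y (forward_jump S t) / y t"
    using has_delta_derivative_jump[OF y \<open>t \<in> S\<close>] pos by (simp add: field_simps)
  then have "cylinder (graininess S t) (D / y t)
      = (ln (y (forward_jump S t)) - ln (y t)) / (forward_jump S t - t)"
    using j pos by (simp add: cylinder_def graininess_def ln_div)
  moreover have "continuous (at t within S) (\<lambda>s. ln (y s))"
    using has_delta_derivative_continuous[OF y \<open>t \<in> S\<close>] pos
    unfolding continuous_within by (intro tendsto_ln) auto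
  ultimately show ?thesis
    using has_delta_derivative_right_scattered_iff[OF \<open>t \<in> S\<close> j] by simp
qed

lemma delta_exp_log_derivative:
  assumes S: "closed S" "\<not> bdd_above S"
    and y: "\<And>t. t \<in> S \<Longrightarrow> has_delta_derivative S y (D t) t"
    and pos: "\<And>t. t \<in> S \<Longrightarrow> 0 < y t"
    and "s \<in> S" "t \<in> S"
  shows "delta_exp S (\<lambda>r. D r / y r) t s = y t / y s"
proof -
  have "delta_integral S (\<lambda>r. cylinder (graininess S r) (D r / y r)) s t = ln (y t) - ln (y s)"
    using S _ \<open>s \<in> S\<close> \<open>t \<in> S\<close>
    by (rule delta_integral_eq) (intro has_delta_derivative_ln y pos forward_jump_mem S; assumption)
  then show ?thesis
    using pos \<open>s \<in> S\<close> \<open>t \<in> S\<close> by (simp add: delta_exp_def exp_diff)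
qed

section \<open>Restricting a continuously differentiable function to a time scale\<close>

text \<open>The jump \<open>\<sigma>(s)\<close> tends to \<open>t\<close> when \<open>s\<close> approaches a right-dense \<open>t\<close>, and also when \<open>s\<close> approaches any
  \<open>t\<close> of \<open>S\<close> from the left, because then \<open>s \<le> \<sigma>(s) \<le> t\<close>. In both cases the points between \<open>s\<close> and
  \<open>\<sigma>(s)\<close> are squeezed to \<open>t\<close>.\<close>

lemma rd_continuous_if_between:
  assumes S: "closed S" "\<not> bdd_above S"
    and g: "\<And>u. isCont g u"
    and D: "\<And>t. t \<in> S \<Longrightarrow> \<exists>u\<in>{t..forward_jump S t}. D t = g u"
  shows "rd_continuous S D"
proof -
  obtain X where X: "\<And>t. t \<in> S \<Longrightarrow> t \<le> X t \<and> X t \<le> forward_jump S t \<and> D t = g (X t)"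
    using bchoice[of S "\<lambda>t u. u \<in> {t..forward_jump S t} \<and> D t = g u"] D by force
  have lim: "(D \<longlongrightarrow> g t) (at t within A)"
    if "A \<subseteq> S" and jump: "(forward_jump S \<longlongrightarrow> t) (at t within A)" for A t
  proof -
    have A: "\<forall>\<^sub>F s in at t within A. s \<in> S"
      unfolding eventually_at using \<open>A \<subseteq> S\<close> by (auto intro: exI[of _ 1])
    have "(X \<longlongrightarrow> t) (at t within A)"
    proof (rule tendsto_sandwich[OF _ _ _ jump])
      show "\<forall>\<^sub>F s in at t within A. s \<le> X s" "\<forall>\<^sub>F s in at t within A. X s \<le> forward_jump S s"
        using A by (auto elim!: eventually_mono dest: X)
    qed (rule tendsto_ident_at)
    then have "((\<lambda>s. g (X s)) \<longlongrightarrow> g t) (at t within A)"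
      by (rule isCont_tendsto_compose[OF g])
    then show ?thesis
      by (rule Lim_transform_eventually) (use A in \<open>auto elim!: eventually_mono dest: X\<close>)
  qed
  show ?thesis unfolding rd_continuous_def
  proof (intro ballI conjI impI)
    fix t assume "t \<in> S" "right_dense S t"
    have "(forward_jump S \<longlongrightarrow> t) (at t within S)"
    proof (rule order_tendstoI)
      fix a assume "a < t"
      then have "\<forall>\<^sub>F s in at t within S. a < s" by (rule order_tendstoD[OF tendsto_ident_at])
      then show "\<forall>\<^sub>F s in at t within S. a < forward_jump S s"
        by (rule eventually_mono) (meson forward_jump_ge less_le_trans)
    next
      fix a assume "t < a"
      then obtain u where u: "u \<in> S" "t < u" "u < a"
        using right_dense_point_near[OF S(2) \<open>right_dense S t\<close>, of "a - t"] by auto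
      from \<open>t < u\<close> have "\<forall>\<^sub>F s in at t within S. s < u" by (rule order_tendstoD[OF tendsto_ident_at])
      then show "\<forall>\<^sub>F s in at t within S. forward_jump S s < a"
        by (rule eventually_mono) (meson forward_jump_le le_less_trans u)
    qed
    then have "(D \<longlongrightarrow> g t) (at t within S)" by (intro lim) auto
    moreover have "D t = g t"
      using X[OF \<open>t \<in> S\<close>] \<open>right_dense S t\<close> by (auto simp: right_dense_def dest: antisym)
    ultimately show "continuous (at t within S) D" by (simp add: continuous_within)
  next
    fix t assume "t \<in> S"
    have "(forward_jump S \<longlongrightarrow> t) (at t within S \<inter> {..<t})"
    proof (rule tendsto_sandwich[OF _ _ tendsto_ident_at tendsto_const])
      show "\<forall>\<^sub>F s in at t within S \<inter> {..<t}. s \<le> forward_jump S s"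
        by (simp add: forward_jump_ge)
      show "\<forall>\<^sub>F s in at t within S \<inter> {..<t}. forward_jump S s \<le> t"
        using forward_jump_le[OF \<open>t \<in> S\<close>] by (auto simp: eventually_at_filter)
    qed
    then have "(D \<longlongrightarrow> g t) (at t within S \<inter> {..<t})" by (intro lim) auto
    then show "\<exists>L. (D \<longlongrightarrow> L) (at t within S \<inter> {..<t})" by blast
  qed
qed

text \<open>By the mean value theorem on the gap \<open>[t, \<sigma>(t)]\<close> the delta derivative is always a value of the
  ordinary derivative at a point not before \<open>t\<close>. Signs and monotone bounds of \<open>g'\<close> therefore carry over
  to the time scale, and so does continuity, as rd-continuity.\<close>

lemma has_delta_derivative_of_C1:
  assumes S: "closed S" "\<not> bdd_above S"
    and g: "\<And>u. (g has_real_derivative g' u) (at u)"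
    and g': "\<And>u. isCont g' u"
  obtains D where "\<And>t. t \<in> S \<Longrightarrow> has_delta_derivative S g (D t) t"
    and "\<And>t. t \<in> S \<Longrightarrow> \<exists>u\<ge>t. D t = g' u" and "rd_continuous S D"
proof -
  define D where
    "D t = (if right_dense S t then g' t
            else (g (forward_jump S t) - g t) / (forward_jump S t - t))" for t
  have deriv: "has_delta_derivative S g (D t) t" if "t \<in> S" for t
  proof (cases "right_dense S t")
    case True
    then show ?thesis
      using g by (simp add: D_def has_delta_derivative_right_dense_iff has_field_derivative_at_within)
  next
    case False
    then have "t < forward_jump S t" by (simp add: right_scattered_iff)
    moreover have "continuous (at t within S) g"
      using g by (meson DERIV_isCont continuous_at_imp_continuous_at_within)
    ultimately show ?thesis
      using False by (simp add: D_def has_delta_derivative_right_scattered_iff[OF that])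
  qed
  have mvt: "\<exists>u\<in>{t..forward_jump S t}. D t = g' u" for t
  proof (cases "right_dense S t")
    case True
    then show ?thesis by (auto simp: D_def right_dense_def)
  next
    case False
    then have j: "t < forward_jump S t" by (simp add: right_scattered_iff)
    obtain u where "t < u" "u < forward_jump S t"
      "g (forward_jump S t) - g t = (forward_jump S t - t) * g' u"
      using MVT2[OF j, of g g'] g by blast
    then show ?thesis
      using False j by (intro bexI[of _ u]) (auto simp: D_def)
  qed
  show thesis
    by (rule that[of D], fact deriv, use mvt in fastforce)
       (intro rd_continuous_if_between[OF S g'] mvt)
qed

lemma rd_continuous_divide:
  assumes "rd_continuous S f" "continuous_on S g" "\<And>t. t \<in> S \<Longrightarrow> g t \<noteq> 0"
  shows "rd_continuous S (\<lambda>t. f t / g t)"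
  unfolding rd_continuous_def
proof (intro ballI conjI impI)
  fix t assume t: "t \<in> S"
  have g: "(g \<longlongrightarrow> g t) (at t within S)"
    using assms(2) t by (simp add: continuous_on_def)
  {
    assume "right_dense S t"
    with assms(1) t have "(f \<longlongrightarrow> f t) (at t within S)"
      by (simp add: rd_continuous_def continuous_within)
    then show "continuous (at t within S) (\<lambda>t. f t / g t)"
      unfolding continuous_within using g assms(3)[OF t] by (intro tendsto_divide)
  next
    assume "left_dense S t"
    with assms(1) t obtain L where "(f \<longlongrightarrow> L) (at t within S \<inter> {..<t})"
      by (auto simp: rd_continuous_def)
    moreover have "(g \<longlongrightarrow> g t) (at t within S \<inter> {..<t})"
      using g by (rule tendsto_within_subset) auto
    ultimately show "\<exists>L. ((\<lambda>t. f t / g t) \<longlongrightarrow> L) (at t within S \<inter> {..<t})"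
      using assms(3)[OF t] tendsto_divide by blast
  }
qed

section \<open>Continuously differentiable minorants of monotone functions\<close>

text \<open>Averaging a decreasing function over \<open>[t, t + 1]\<close> keeps it decreasing, lowers it, and raises its
  smoothness by one degree: a monotone function becomes continuous, a continuous one \<open>C\<^sup>1\<close>.\<close>

definition moving_average :: "(real \<Rightarrow> real) \<Rightarrow> real \<Rightarrow> real" where
  "moving_average f t = integral {t..t + 1} f"

lemma moving_average_shift: "moving_average f t = integral {0..1} (\<lambda>u. f (u + t))"
  using integral_shift_real_ivl[of t t "t + 1" f] by (simp add: moving_average_def)

context
  fixes f :: "real \<Rightarrow> real"
  assumes f: "antimono f"
begin

lemma antimono_integrable: "f integrable_on {a..b}"
proof -
  have "(\<lambda>t. - f t) integrable_on {a..b}"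
    by (rule integrable_on_mono_on) (use f in \<open>auto simp: mono_on_def antimono_def\<close>)
  then show ?thesis using integrable_neg by fastforce
qed

lemma antimono_integrable_shift: "(\<lambda>u. f (u + t)) integrable_on {0..1}"
  using integrable_shift_real_ivl[OF antimono_integrable[of t "t + 1"], of t] by simp

lemma antimono_moving_average: "antimono (moving_average f)"
  unfolding antimono_def moving_average_shift
  using f by (auto intro!: integral_le antimono_integrable_shift simp: antimono_def)

lemma moving_average_le: "moving_average f t \<le> f t"
proof -
  have "moving_average f t \<le> integral {t..t + 1} (\<lambda>_. f t)"
    unfolding moving_average_def
    by (intro integral_le antimono_integrable) (use f in \<open>auto simp: antimono_def\<close>)
  then show ?thesis by simp
qed

lemma moving_average_ge: "f (t + 1) \<le> moving_average f t"
proof -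
  have "integral {t..t + 1} (\<lambda>_. f (t + 1)) \<le> moving_average f t"
    unfolding moving_average_def
    by (intro integral_le antimono_integrable) (use f in \<open>auto simp: antimono_def\<close>)
  then show ?thesis by simp
qed

lemma moving_average_eq_diff:
  assumes "b \<le> t"
  shows "moving_average f t = integral {b..t + 1} f - integral {b..t} f"
  using Henstock_Kurzweil_Integration.integral_combine[of b t "t + 1" f] assms antimono_integrable
  by (simp add: moving_average_def)

lemma isCont_moving_average: "isCont (moving_average f) t"
proof -
  define I where "I u = integral {t - 1..u} f" for u
  have I: "continuous_on {t - 1..t + 3} I"
    unfolding I_def by (intro indefinite_integral_continuous_1 antimono_integrable)
  have "continuous_on {t - 1..t + 1} (\<lambda>u. I (u + 1) - I u)"
    by (intro continuous_intros continuous_on_compose2[OF I] continuous_on_subset[OF I]) auto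
  then have "continuous_on {t - 1..t + 1} (moving_average f)"
    by (rule continuous_on_eq) (use moving_average_eq_diff in \<open>auto simp: I_def\<close>)
  then have "continuous_on {t - 1<..<t + 1} (moving_average f)"
    by (rule continuous_on_subset) auto
  then show ?thesis by (simp add: continuous_on_eq_continuous_at)
qed

lemma DERIV_moving_average:
  assumes "\<And>u. isCont f u"
  shows "(moving_average f has_real_derivative f (t + 1) - f t) (at t)"
proof -
  define I where "I u = integral {t - 1..u} f" for u
  have I: "(I has_real_derivative f s) (at s)" if "t - 1 < s" "s < t + 2" for s
  proof -
    have "(I has_real_derivative f s) (at s within {t - 1..t + 2})"
      unfolding I_def
      by (rule integral_has_real_derivative) (use that assms in \<open>auto intro: continuous_at_imp_continuous_on\<close>)
    moreover have "at s within {t - 1..t + 2} = at s"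
      using that by (intro at_within_interior) auto
    ultimately show ?thesis by simp
  qed
  have "((\<lambda>u. I (u + 1) - I u) has_real_derivative f (t + 1) - f t) (at t)"
    by (intro DERIV_diff I DERIV_shift[THEN iffD1]) auto
  then show ?thesis
  proof (rule has_field_derivative_transform_within[where d=1])
    fix u assume "dist u t < 1"
    then show "I (u + 1) - I u = moving_average f u"
      using moving_average_eq_diff[of "t - 1" u] by (auto simp: I_def dist_real_def)
  qed auto
qed

end

text \<open>Two averagings give a decreasing \<open>C\<^sup>1\<close> function below \<open>k\<close> whose slope, a difference of two values
  of the first average, is bounded by \<open>k\<close> as well. The exponential factor makes the slope strictly
  negative.\<close>

lemma C1_minorant:
  fixes k :: "real \<Rightarrow> real"
  assumes k: "antimono k" "\<And>t. 0 < k t"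
  obtains z z' where "\<And>t. (z has_real_derivative z' t) (at t)" "\<And>t. isCont z' t"
    and "\<And>t. a \<le> t \<Longrightarrow> 0 < z t \<and> z t \<le> k t \<and> z' t < 0 \<and> - k t \<le> z' t"
proof -
  define w where "w = moving_average k"
  define v where "v = moving_average w"
  have w: "antimono w" "\<And>t. isCont w t"
    unfolding w_def by (rule antimono_moving_average isCont_moving_average, fact k)+
  have v: "isCont v t" "(v has_real_derivative w (t + 1) - w t) (at t)" for t
    unfolding v_def by (rule isCont_moving_average DERIV_moving_average; fact w)+
  have wk: "w t \<le> k t" "0 < w t" for t
    using moving_average_le[OF k(1)] moving_average_ge[OF k(1)] k(2) less_le_trans
    unfolding w_def by blast+
  have vw: "v t \<le> w t" "0 < v t" for t
    using moving_average_le[OF w(1)] moving_average_ge[OF w(1)] wk(2) less_le_trans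
    unfolding v_def by blast+
  define z where "z t = exp (a - t) * v t / 2" for t
  define z' where "z' t = exp (a - t) * (w (t + 1) - w t - v t) / 2" for t
  show thesis
  proof (rule that[of z z'])
    have exp': "((\<lambda>t. exp (a - t)) has_real_derivative - exp (a - t)) (at t)" for t
      by (auto intro!: derivative_eq_intros)
    show "(z has_real_derivative z' t) (at t)" for t
      unfolding z_def z'_def
      by (rule DERIV_cong[OF DERIV_cdivide[OF DERIV_mult[OF exp' v(2)]]]) (simp add: algebra_simps)
    have "isCont (\<lambda>t. w (t + 1)) t" for t
      by (rule isCont_o2[OF _ w(2)]) (intro continuous_intros)
    then show "isCont z' t" for t
      unfolding z'_def by (intro continuous_intros v w) auto
    fix t assume "a \<le> t"
    then have e: "0 < exp (a - t)" "exp (a - t) \<le> 1" by auto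
    have "w (t + 1) \<le> w t" using w(1) by (simp add: antimono_def)
    have *: "exp (a - t) * c \<le> c" if "0 \<le> c" for c
      using mult_right_mono[OF e(2) that] by simp
    have "z t \<le> k t"
      using *[OF less_imp_le[OF vw(2)[of t]]] vw[of t] wk[of t] unfolding z_def by linarith
    moreover have "- z' t \<le> k t"
    proof -
      have "- z' t = exp (a - t) * (v t + w t - w (t + 1)) / 2"
        by (simp add: z'_def field_simps)
      also have "\<dots> \<le> (v t + w t - w (t + 1)) / 2"
        using \<open>w (t + 1) \<le> w t\<close> vw(2)[of t] by (intro divide_right_mono *) auto
      also have "\<dots> \<le> k t" using vw(1)[of t] wk(1)[of t] wk(2)[of "t + 1"] by simp
      finally show ?thesis .
    qed
    moreover have "z' t < 0"
      using e(1) \<open>w (t + 1) \<le> w t\<close> vw(2)[of t] by (simp add: z'_def mult_pos_neg)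
    ultimately show "0 < z t \<and> z t \<le> k t \<and> z' t < 0 \<and> - k t \<le> z' t"
      using vw(2)[of t] by (simp add: z_def)
  qed
qed

text \<open>A positive continuous function may have infimum \<open>0\<close> on \<open>S\<close>, but on each bounded piece \<open>R s\<close> it
  stays away from \<open>0\<close>. Below, \<open>R s\<close> is the set of times at which a delayed argument is at most \<open>s\<close>.\<close>

lemma antimono_minorant:
  fixes c :: "real \<Rightarrow> real" and R :: "real \<Rightarrow> real set"
  assumes S: "closed S" "bdd_below S"
    and c: "continuous_on S c" "\<And>t. t \<in> S \<Longrightarrow> 0 < c t"
    and R: "mono R" "\<And>s. R s \<subseteq> S" "\<And>s. bdd_above (R s)"
  obtains k where "antimono k" "\<And>s. (0::real) < k s" "\<And>s t. t \<in> R s \<Longrightarrow> k s \<le> c t"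
proof -
  have low: "\<exists>e>0. \<forall>t\<in>R s. e \<le> c t" for s
  proof (cases "R s = {}")
    case False
    obtain a b where ab: "S \<subseteq> {a..}" "R s \<subseteq> {..b}"
      using S(2) R(3)[of s] by (auto simp: bdd_below_def bdd_above_def)
    have "compact (S \<inter> {a..b})" using S(1) by (simp add: closed_Int_compact)
    moreover have "R s \<subseteq> S \<inter> {a..b}" using ab R(2)[of s] by (auto simp: subset_iff)
    moreover from this False have "S \<inter> {a..b} \<noteq> {}" by blast
    ultimately obtain m where "m \<in> S" "\<forall>t\<in>R s. c m \<le> c t"
      using continuous_attains_inf[of "S \<inter> {a..b}" c] continuous_on_subset[OF c(1)]
      by (metis IntD1 inf_le1 subsetD)
    then show ?thesis using c(2) by blast
  qed (auto intro: exI[of _ 1])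
  \<comment> \<open>The extra element \<open>1\<close> gives the infimum a positive value when \<open>R s\<close> is empty.\<close>
  define k where "k s = Inf (insert 1 (c ` R s))" for s
  have bdd: "bdd_below (insert 1 (c ` R s))" for s
    using c(2) R(2)[of s] by (intro bdd_belowI[of _ 0]) (auto intro: less_imp_le)
  show thesis
  proof (rule that[of k])
    show "antimono k"
    proof (rule antimonoI)
      fix s s' :: real
      assume "s \<le> s'"
      then have "insert 1 (c ` R s) \<subseteq> insert 1 (c ` R s')"
        using R(1) by (auto simp: mono_def)
      then show "k s' \<le> k s"
        unfolding k_def by (intro cInf_superset_mono bdd) auto
    qed
    show "0 < k s" for s
    proof -
      obtain e where e: "e > 0" "\<forall>t\<in>R s. e \<le> c t" using low by blast
      have "min 1 e \<le> k s" unfolding k_def using e by (intro cInf_greatest) auto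
      with e show ?thesis by linarith
    qed
    show "k s \<le> c t" if "t \<in> R s" for s t
      unfolding k_def using that by (intro cInf_lower bdd) auto
  qed
qed

section \<open>Delay inequalities\<close>

text \<open>The step that crosses a gap is \<open>(y - x)(\<sigma>) = (1 - \<mu> p) (y - x) + \<mu> ((y' + p y) - (x' + p x))\<close>, where
  both summands are nonnegative as \<open>\<mu> p \<le> 1\<close>. At a right-dense point either \<open>x < y\<close> persists by
  continuity, or \<open>x = y\<close> and the strict inequality makes \<open>y - x\<close> grow. The inequality may be checked
  knowing \<open>x \<le> y\<close> at all earlier times, which is what delayed terms require.\<close>

lemma delta_comparison:
  assumes S: "closed S" "\<not> bdd_above S" and "M \<in> S"
    and x: "\<And>t. t \<in> S \<Longrightarrow> M \<le> t \<Longrightarrow> has_delta_derivative S x (x' t) t"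
    and y: "\<And>t. t \<in> S \<Longrightarrow> M \<le> t \<Longrightarrow> has_delta_derivative S y (y' t) t"
    and p: "\<And>t. t \<in> S \<Longrightarrow> M \<le> t \<Longrightarrow> graininess S t * p t \<le> 1"
    and init: "\<And>s. s \<in> S \<Longrightarrow> s \<le> M \<Longrightarrow> x s \<le> y s"
    and ineq: "\<And>t. t \<in> S \<Longrightarrow> M \<le> t \<Longrightarrow> (\<And>s. s \<in> S \<Longrightarrow> s \<le> t \<Longrightarrow> x s \<le> y s) \<Longrightarrow>
      x' t + p t * x t < y' t + p t * y t"
    and "t \<in> S"
  shows "x t \<le> y t"
proof (cases "t \<le> M")
  case True
  with init \<open>t \<in> S\<close> show ?thesis by blast
next
  case False
  with \<open>t \<in> S\<close> have "t \<in> S \<inter> {M..}" by simp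
  with S \<open>M \<in> S\<close> show ?thesis
  proof (induction rule: time_scale_induct)
    case base
    show ?case using init \<open>M \<in> S\<close> by blast
  next
    case (scattered t)
    have upto: "x s \<le> y s" if "s \<in> S" "s \<le> t" for s
      using init scattered(4) that by (cases "s \<le> M") auto
    have "x t \<le> y t" using upto scattered by blast
    note jumps = has_delta_derivative_jump[OF x \<open>t \<in> S\<close>, OF scattered(1,2)]
      has_delta_derivative_jump[OF y \<open>t \<in> S\<close>, OF scattered(1,2)]
    have "0 \<le> (1 - graininess S t * p t) * (y t - x t)"
      using p[OF scattered(1,2)] \<open>x t \<le> y t\<close> by simp
    moreover have "0 \<le> graininess S t * ((y' t + p t * y t) - (x' t + p t * x t))"
      using ineq[OF scattered(1,2) upto] forward_jump_ge[of t S]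
      by (intro mult_nonneg_nonneg) (auto simp: graininess_def)
    ultimately show ?case unfolding jumps by (simp add: algebra_simps)
  next
    case (right_dense t)
    have upto: "x s \<le> y s" if "s \<in> S" "s \<le> t" for s
      using init right_dense(4) that by (cases "s \<le> M") auto
    have deriv: "((\<lambda>s. y s - x s) has_real_derivative y' t - x' t) (at t within S)"
      using has_delta_derivative_diff[OF y x, OF right_dense(1,2) right_dense(1,2)]
      by (simp add: has_delta_derivative_right_dense_iff[OF right_dense(3)])
    show ?case
    proof (cases "x t = y t")
      case True
      with ineq[OF right_dense(1,2) upto] have "0 < y' t - x' t" by simp
      from has_real_derivative_pos_inc_right[OF deriv this] obtain d where
        d: "d > 0" "\<And>h. 0 < h \<Longrightarrow> t + h \<in> S \<Longrightarrow> h < d \<Longrightarrow> y t - x t < y (t + h) - x (t + h)"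
        by blast
      have "x u \<le> y u" if "u \<in> S" "t < u" "u < t + d" for u
        using d(2)[of "u - t"] that True by simp
      with d(1) show ?thesis by blast
    next
      case False
      with upto right_dense(1) have "0 < y t - x t" by fastforce
      moreover have "((\<lambda>s. y s - x s) \<longlongrightarrow> y t - x t) (at t within S)"
        using DERIV_continuous[OF deriv] by (simp add: continuous_within)
      ultimately have "\<forall>\<^sub>F s in at t within S. 0 < y s - x s" by (rule order_tendstoD(1)[rotated])
      then obtain d where "d > 0" "\<And>s. s \<in> S \<Longrightarrow> s \<noteq> t \<Longrightarrow> dist s t < d \<Longrightarrow> 0 < y s - x s"
        by (auto simp: eventually_at)
      then show ?thesis by (intro exI[of _ d]) (force simp: dist_real_def)
    qed
  next
    case (left_dense t)
    have lim: "(f \<longlongrightarrow> f t) (at t within S \<inter> {..<t})"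
      if "has_delta_derivative S f D t" for f D
      using has_delta_derivative_continuous[OF that left_dense(1)]
      by (meson continuous_within inf_le1 tendsto_within_subset)
    have "\<forall>\<^sub>F u in at t within S \<inter> {..<t}. x u \<le> y u"
      unfolding eventually_at using left_dense
      by (intro exI[of _ "t - M"]) (auto simp: dist_real_def)
    moreover have "at t within S \<inter> {..<t} \<noteq> bot"
      using \<open>left_dense S t\<close> by (simp add: left_dense_def trivial_limit_within)
    ultimately show ?case
      using left_dense(1,2) by (intro tendsto_le[OF _ lim[OF y] lim[OF x]]) auto
  qed
qed

text \<open>Values at least \<open>1\<close> are where the sublinear term is dominated by the linear one; this is why the
  majorant must stay above \<open>1\<close>, and why it cannot be required to decay to \<open>0\<close> when \<open>l < 1\<close>.\<close>

lemma real_pow_le: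
  assumes "u \<le> w" "1 \<le> w" "0 < l" "l \<le> 1"
  shows "real_pow u l \<le> w"
proof (cases "0 \<le> u")
  case True
  then have "u powr l \<le> w powr l" using assms by (intro powr_mono2) auto
  also have "\<dots> \<le> w powr 1" using assms by (intro powr_mono) auto
  finally show ?thesis using True assms by (simp add: real_pow_def)
next
  case False
  then have "real_pow u l \<le> 0" by (simp add: real_pow_def)
  with assms show ?thesis by linarith
qed

text \<open>With \<open>Q = \<Sum>q\<^sub>i\<close> and \<open>y = K (1 + z)\<close>, \<open>z\<close> small and decreasing, the terms on the right at time \<open>t\<close> are at most
  \<open>K Q (1 + z(s))\<close> with \<open>s\<close> the earliest delayed argument, and \<open>y\<^sup>\<Delta> + p y \<ge> K (p - sup |z'|)\<close>. So \<open>y\<close> is a strict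
  supersolution once \<open>z\<close> and \<open>|z'|\<close> are bounded on \<open>[s, \<infinity>)\<close> by \<open>c(t) = (p - Q) / (2 + Q)\<close>. Since only a bounded
  set of times \<open>t\<close> has a delayed argument up to \<open>s\<close>, the restriction on \<open>z(s)\<close> is a positive bound, and
  such a \<open>z\<close> exists even if \<open>p - Q\<close> is not bounded away from \<open>0\<close>.\<close>

lemma sublinear_delay_inequality_decay:
  fixes S :: "real set" and \<tau> :: "nat \<Rightarrow> real \<Rightarrow> real" and q :: "nat \<Rightarrow> real \<Rightarrow> real"
  assumes S: "closed S" "\<not> bdd_above S" "a \<in> S" "S \<subseteq> {a..}"
    and \<tau>: "\<And>i t. i \<le> r \<Longrightarrow> t \<in> S \<Longrightarrow> \<tau> i t \<le> t"
      "\<And>i t. i \<le> r \<Longrightarrow> t \<in> S \<Longrightarrow> a \<le> \<tau> i t \<Longrightarrow> \<tau> i t \<in> S"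
      "\<And>i s. i \<le> r \<Longrightarrow> bdd_above {t \<in> S. \<tau> i t \<le> s}"
    and l: "0 < l" "l \<le> 1"
    and x: "\<And>t. t \<in> S \<Longrightarrow> has_delta_derivative S x (x' t) t"
    and ineq: "\<And>t. t \<in> S \<Longrightarrow> x' t \<le> - p t * x t + (\<Sum>i=0..r. q i t * real_pow (x (\<tau> i t)) l)"
    and cont: "continuous_on S p" "\<And>i. i \<le> r \<Longrightarrow> continuous_on S (q i)"
    and p: "\<And>t. t \<in> S \<Longrightarrow> graininess S t * p t \<le> 1"
    and q: "\<And>i t. i \<le> r \<Longrightarrow> t \<in> S \<Longrightarrow> 0 \<le> q i t"
    and pq: "\<And>t. t \<in> S \<Longrightarrow> 0 < p t - (\<Sum>i=0..r. q i t)"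
  shows "\<exists>lam K. positively_regressive S lam \<and> (\<forall>t\<in>S. lam t < 0) \<and> 1 < K \<and>
    (\<forall>t\<in>S. x t \<le> K * delta_exp S lam t a)"
proof -
  define Q where "Q t = (\<Sum>i=0..r. q i t)" for t
  define c where "c t = (p t - Q t) / (2 + Q t)" for t
  define R where "R s = {t \<in> S. \<exists>i\<le>r. \<tau> i t \<le> s}" for s
  have Q: "0 \<le> Q t" if "t \<in> S" for t
    using q that by (auto simp: Q_def intro: sum_nonneg)
  have c_pos: "0 < c t" if "t \<in> S" for t
    using Q[OF that] pq[OF that] by (simp add: c_def Q_def)
  have "continuous_on S Q"
    unfolding Q_def by (intro continuous_on_sum cont) auto
  moreover have "\<forall>t\<in>S. 2 + Q t \<noteq> 0" using Q by force
  ultimately have c_cont: "continuous_on S c"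
    unfolding c_def by (intro continuous_intros cont)
  have R: "mono R" "\<And>s. R s \<subseteq> S"
    by (auto simp: R_def mono_def)
  have R_bdd: "bdd_above (R s)" for s
  proof -
    have "R s = (\<Union>i\<in>{..r}. {t \<in> S. \<tau> i t \<le> s})" by (auto simp: R_def)
    then show ?thesis using \<tau>(3) by simp
  qed
  have "bdd_below S" using S(4) by (auto intro: bdd_belowI)
  then obtain k where k: "antimono k" "\<And>s. 0 < k s" "\<And>s t. t \<in> R s \<Longrightarrow> k s \<le> c t"
    using antimono_minorant[OF S(1) _ c_cont c_pos R R_bdd] by blast
  obtain z z' where z: "\<And>t. (z has_real_derivative z' t) (at t)" "\<And>t. isCont z' t"
    and zk: "\<And>t. a \<le> t \<Longrightarrow> 0 < z t \<and> z t \<le> k t \<and> z' t < 0 \<and> - k t \<le> z' t"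
    using C1_minorant[OF k(1,2), of a] by blast
  \<comment> \<open>Beyond \<open>M\<close> no delayed argument precedes \<open>a\<close>; up to \<open>M\<close> the majorant holds by the choice of \<open>K\<close>.\<close>
  obtain N where N: "\<And>t. t \<in> R a \<Longrightarrow> t \<le> N"
    using R_bdd[of a] by (auto simp: bdd_above_def)
  obtain M where M: "M \<in> S" "N < M"
    using S(2) unfolding bdd_above_def by (meson not_le)
  have \<tau>_S: "\<tau> i t \<in> S" if "i \<le> r" "t \<in> S" "M \<le> t" for i t
  proof (rule \<tau>(2))
    show "a \<le> \<tau> i t" using N[of t] M that by (force simp: R_def)
  qed fact+
  have "continuous_on S x"
    using has_delta_derivative_continuous[OF x] by (simp add: continuous_on_eq_continuous_within)
  then have "compact (x ` (S \<inter> {a..M}))"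
    using S(1) by (intro compact_continuous_image closed_Int_compact) (auto intro: continuous_on_subset)
  then have "bdd_above (x ` (S \<inter> {a..M}))"
    by (intro bounded_imp_bdd_above compact_imp_bounded)
  then obtain B where B: "\<And>s. s \<in> S \<Longrightarrow> s \<le> M \<Longrightarrow> x s \<le> B"
    using S(4) by (force simp: bdd_above_def)
  define K where "K = max 1 B"
  have K: "1 \<le> K" "B \<le> K" by (auto simp: K_def)
  define y where "y t = K * (1 + z t)" for t
  have y_deriv: "(y has_real_derivative K * z' t) (at t)" for t
    unfolding y_def by (auto intro!: derivative_eq_intros z)
  have y_ge: "K < y t" if "t \<in> S" for t
    using zk[of t] that S(4) K by (auto simp: y_def algebra_simps)
  have "isCont (\<lambda>t. K * z' t) u" for u by (intro continuous_intros z)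
  from has_delta_derivative_of_C1[OF S(1,2) y_deriv this] obtain D where
    D: "\<And>t. t \<in> S \<Longrightarrow> has_delta_derivative S y (D t) t"
      "\<And>t. t \<in> S \<Longrightarrow> \<exists>u\<ge>t. D t = K * z' u" "rd_continuous S D" by blast
  have D_bounds: "D t < 0" "- K * k t \<le> D t" if "t \<in> S" for t
  proof -
    obtain u where u: "t \<le> u" "D t = K * z' u" using D(2)[OF \<open>t \<in> S\<close>] by blast
    with S(4) that have "a \<le> u" by force
    then have "- k u \<le> z' u" "z' u < 0" using zk by auto
    moreover have "k u \<le> k t" using k(1) u(1) by (simp add: antimono_def)
    ultimately show "D t < 0" "- K * k t \<le> D t"
      using K(1) mult_left_mono[of "- k t" "z' u" K] by (auto simp: u(2) mult_pos_neg)
  qed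
  have majorant: "x t \<le> y t" if "t \<in> S" for t
    using S(1,2) M(1) x D(1) p _ _ that
  proof (rule delta_comparison)
    show "x s \<le> y s" if "s \<in> S" "s \<le> M" for s
      using B[OF that] y_ge[OF that(1)] K by linarith
  next
    fix t assume t: "t \<in> S" "M \<le> t" and upto: "\<And>s. s \<in> S \<Longrightarrow> s \<le> t \<Longrightarrow> x s \<le> y s"
    have delayed: "real_pow (x (\<tau> i t)) l \<le> K * (1 + c t)" if "i \<le> r" for i
    proof -
      have s: "\<tau> i t \<in> S" "\<tau> i t \<le> t" "t \<in> R (\<tau> i t)"
        using \<tau>_S[OF that t] \<tau>(1)[OF that t(1)] that t by (auto simp: R_def)
      have "real_pow (x (\<tau> i t)) l \<le> y (\<tau> i t)"
        using upto[OF s(1,2)] y_ge[OF s(1)] K l by (intro real_pow_le) auto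
      also have "\<dots> \<le> K * (1 + c t)"
        using zk[of "\<tau> i t"] s(1) S(4) k(3)[OF s(3)] K unfolding y_def
        by (intro mult_left_mono) force+
      finally show ?thesis .
    qed
    have "x' t + p t * x t \<le> (\<Sum>i=0..r. q i t * real_pow (x (\<tau> i t)) l)"
      using ineq[OF t(1)] by simp
    also have "\<dots> \<le> (\<Sum>i=0..r. q i t * (K * (1 + c t)))"
      using delayed q t by (intro sum_mono mult_left_mono) auto
    also have "\<dots> = K * (Q t * (1 + c t))"
      by (simp add: Q_def sum_distrib_right[symmetric])
    also have "\<dots> < K * (p t - c t)"
    proof -
      have "p t - Q t = c t * (2 + Q t)" using Q[OF t(1)] by (simp add: c_def)
      then show ?thesis using c_pos[OF t(1)] K by (intro mult_strict_left_mono) (auto simp: algebra_simps)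
    qed
    also have "\<dots> \<le> D t + p t * y t"
    proof -
      \<comment> \<open>Delayed arguments never exceed \<open>t\<close>, so \<open>k t\<close> is also below the margin at \<open>t\<close> itself.\<close>
      have "t \<in> R t" using t \<tau>(1)[of 0 t] by (auto simp: R_def)
      then have "- K * c t \<le> D t"
        using D_bounds(2)[OF t(1)] mult_left_mono[OF k(3)[of t t], of K] K by linarith
      moreover have "p t * K \<le> p t * y t"
        using pq[OF t(1)] Q[OF t(1)] y_ge[OF t(1)] by (intro mult_left_mono) (auto simp: Q_def)
      ultimately show ?thesis by (simp add: algebra_simps)
    qed
    finally show "x' t + p t * x t < D t + p t * y t" .
  qed
  define lam where "lam t = D t / y t" for t
  have y_pos: "0 < y t" if "t \<in> S" for t using y_ge[OF that] K by linarith
  show ?thesis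
  proof (intro exI[of _ lam] exI[of _ "y a"] conjI ballI)
    have "continuous_on S y"
      using y_deriv by (meson DERIV_isCont continuous_at_imp_continuous_on)
    then have "rd_continuous S lam"
      unfolding lam_def using y_pos by (intro rd_continuous_divide D(3)) force+
    moreover have "0 < 1 + graininess S t * lam t" if "t \<in> S" for t
    proof -
      have "1 + graininess S t * lam t = y (forward_jump S t) / y t"
        using has_delta_derivative_jump[OF D(1)] that y_pos[OF that] by (simp add: lam_def field_simps)
      then show ?thesis using y_pos[OF that] y_pos[OF forward_jump_mem[OF S(1,2)]] by simp
    qed
    ultimately show "positively_regressive S lam" by (simp add: positively_regressive_def)
    show "lam t < 0" if "t \<in> S" for t
      using D_bounds(1)[OF that] y_pos[OF that] by (simp add: lam_def divide_neg_pos)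
    \<comment> \<open>The factor \<open>y a\<close> cancels the normalisation \<open>e(a, a) = 1\<close> of the exponential.\<close>
    show "1 < y a" using y_ge[OF S(3)] K by linarith
    show "x t \<le> y a * delta_exp S lam t a" if "t \<in> S" for t
      using majorant[OF that] delta_exp_log_derivative[OF S(1,2) D(1) y_pos S(3) that] y_pos[OF S(3)]
      by (simp add: lam_def[abs_def])
  qed
qed

section \<open>Shift operators as delays\<close>

text \<open>The axiom \<open>\<delta>\<^sub>+(t, t\<^sub>0) = t\<close> places \<open>[t\<^sub>0, \<infinity>)\<close> of the time scale inside the domain of the shifts, and
  \<open>\<delta>\<^sub>-(t\<^sub>0, \<cdot>)\<close> inverts \<open>\<delta>\<^sub>+(t\<^sub>0, \<cdot>)\<close>, the identity.\<close>

lemma shift_initial: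
  assumes "shift_operators T Ts t0 \<delta>m \<delta>p" "t \<in> T \<inter> {t0..}"
  shows "(t0, t) \<in> shift_dom T Ts t0 \<delta>m" "\<delta>m t0 t = t"
proof -
  have "\<delta>p t t0 = t" "(t, t0) \<in> shift_dom T Ts t0 \<delta>p"
    using assms unfolding shift_operators_def by blast+
  then have "t \<in> Ts" by (simp add: shift_dom_def)
  then have t: "(t0, t) \<in> shift_dom T Ts t0 \<delta>p" "\<delta>p t0 t = t"
    using assms unfolding shift_operators_def by blast+
  moreover have "shift_inverse T Ts t0 \<delta>p \<delta>m"
    using assms unfolding shift_operators_def by blast
  ultimately show "(t0, t) \<in> shift_dom T Ts t0 \<delta>m" "\<delta>m t0 t = t"
    unfolding shift_inverse_def by metis+
qed

lemma delay_less:
  assumes "shift_operators T Ts t0 \<delta>m \<delta>p" "delay_function T Ts t0 \<delta>m \<delta>p h" "t \<in> T \<inter> {t0..}"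
  shows "\<delta>m h t < t"
proof -
  have "(h, t) \<in> shift_dom T Ts t0 \<delta>m" "t0 < h"
    using assms(2,3) unfolding delay_function_def by auto
  then have "\<delta>m h t < \<delta>m t0 t"
    using assms(1) shift_initial[OF assms(1,3)] unfolding shift_operators_def by blast
  then show ?thesis using shift_initial[OF assms(1,3)] by simp
qed

lemma delay_mem:
  assumes "shift_operators T Ts t0 \<delta>m \<delta>p" "delay_function T Ts t0 \<delta>m \<delta>p h" "t \<in> T \<inter> {t0..}"
  shows "\<delta>m h t \<in> T"
proof -
  have "(h, t) \<in> shift_dom T Ts t0 \<delta>m" using assms(2,3) unfolding delay_function_def by blast
  moreover have "Ts \<subseteq> T" using assms(1) unfolding shift_operators_def by blast
  ultimately show ?thesis by (auto simp: shift_dom_def)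
qed

text \<open>A delayed argument tends to infinity: the delay is onto an unbounded set, hence exceeds \<open>s\<close> at some
  \<open>u\<close>, and stays above by monotonicity.\<close>

lemma delay_sublevel_bdd:
  assumes "shift_operators T Ts t0 \<delta>m \<delta>p" "delay_function T Ts t0 \<delta>m \<delta>p h" "\<not> bdd_above T"
  shows "bdd_above {t \<in> T \<inter> {t0..}. \<delta>m h t \<le> s}"
proof -
  have h: "t0 < h" "\<And>t. t \<in> T \<inter> {t0..} \<Longrightarrow> (h, t) \<in> shift_dom T Ts t0 \<delta>m"
    "\<delta>m h ` (T \<inter> {t0..}) = T \<inter> {\<delta>m h t0..}"
    using assms(2) unfolding delay_function_def by auto
  \<comment> \<open>Monotonicity of the shift by \<open>h\<close> is postulated only from \<open>h\<close> on; as \<open>u\<close> will exceed \<open>v\<close>, taking \<open>v > h\<close> ensures \<open>u > h\<close>.\<close>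
  obtain v where v: "v \<in> T" "v > Max {s, h, \<delta>m h t0}"
    using assms(3) unfolding bdd_above_def by (meson not_le)
  then have "v \<in> \<delta>m h ` (T \<inter> {t0..})" unfolding h(3) by auto
  then obtain u where u: "u \<in> T \<inter> {t0..}" "\<delta>m h u = v" by blast
  have "h < u" using delay_less[OF assms(1,2) u(1)] u(2) v(2) by simp
  have "t \<le> u" if t: "t \<in> T \<inter> {t0..}" "\<delta>m h t \<le> s" for t
  proof (rule ccontr)
    assume "\<not> t \<le> u"
    moreover have "shift_mono T Ts t0 \<delta>m"
      using assms(1) unfolding shift_operators_def by blast
    ultimately have "\<delta>m h u < \<delta>m h t"
      using \<open>h < u\<close> h(2)[OF u(1)] h(2)[OF t(1)] unfolding shift_mono_def by force
    with u t v show False by simp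
  qed
  then show ?thesis by (intro bdd_aboveI) auto
qed

section \<open>The decay estimate\<close>

lemma forward_jump_Int_atLeast:
  "t0 \<le> t \<Longrightarrow> forward_jump (T \<inter> {t0..}) t = forward_jump T t"
proof -
  assume "t0 \<le> t"
  then have "{s \<in> T \<inter> {t0..}. t < s} = {s \<in> T. t < s}" by auto
  moreover from \<open>t0 \<le> t\<close> have "(\<exists>s\<in>T \<inter> {t0..}. t < s) \<longleftrightarrow> (\<exists>s\<in>T. t < s)" by auto
  ultimately show ?thesis by (simp add: forward_jump_def)
qed

text \<open>The supremum is over a bounded set, as no gap beginning in \<open>[a, t]\<close> reaches past \<open>\<sigma>(t)\<close>.\<close>

lemma graininess_le_sup_graininess:
  assumes "t \<in> T" "a \<le> t"
  shows "graininess T t \<le> sup_graininess T a t"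
  unfolding sup_graininess_def
proof (rule cSUP_upper)
  show "t \<in> T \<inter> {a..t}" using assms by auto
  have "graininess T s \<le> forward_jump T t - a" if "s \<in> T \<inter> {a..t}" for s
  proof (cases "s = t")
    case False
    then have "forward_jump T s \<le> t" using that assms by (intro forward_jump_le) auto
    also have "t \<le> forward_jump T t" by (rule forward_jump_ge)
    finally show ?thesis using that by (simp add: graininess_def)
  qed (use that in \<open>simp add: graininess_def\<close>)
  then show "bdd_above (graininess T ` (T \<inter> {a..t}))" by (rule bdd_aboveI2)
qed

theorem theorem2:
  fixes T Ts :: "real set" and t0 l :: real
    and \<delta>m \<delta>p :: "real \<Rightarrow> real \<Rightarrow> real"
    and r :: nat and h :: "nat \<Rightarrow> real"
    and x x' p :: "real \<Rightarrow> real" and q :: "nat \<Rightarrow> real \<Rightarrow> real"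
  assumes "time_scale T" and "\<not> bdd_above T" and "\<not> bdd_above Ts"
    and "shift_operators T Ts t0 \<delta>m \<delta>p"
    and "h 0 = t0" and "\<And>i. i < r \<Longrightarrow> h i < h (Suc i)"
    and "\<And>i. i \<in> {1..r} \<Longrightarrow> delay_function T Ts t0 \<delta>m \<delta>p (h i)"
    and "0 < l" and "l \<le> 1"
    and "\<And>t. t \<in> T \<inter> {t0..} \<Longrightarrow> has_delta_derivative (T \<inter> {t0..}) x (x' t) t"
    and "\<And>t. t \<in> T \<inter> {t0..} \<Longrightarrow>
           x' t \<le> - p t * x t + (\<Sum>i=0..r. q i t * real_pow (x (\<delta>m (h i) t)) l)"
    and "continuous_on (T \<inter> {t0..}) p" and "bounded (p ` (T \<inter> {t0..}))"
    and "\<And>i. i \<le> r \<Longrightarrow> continuous_on (T \<inter> {t0..}) (q i)"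
    and "\<And>i. i \<le> r \<Longrightarrow> bounded (q i ` (T \<inter> {t0..}))"
    and "\<And>t. t \<in> T \<inter> {t0..} \<Longrightarrow> 1 - sup_graininess T (\<delta>m (h r) t0) t * p t \<ge> 0"
    and "\<And>i t. i < r \<Longrightarrow> t \<in> T \<inter> {t0..} \<Longrightarrow> q i t \<ge> 0"
    and "\<And>t. t \<in> T \<inter> {t0..} \<Longrightarrow> q r t > 0"
    and "\<And>t. t \<in> T \<inter> {t0..} \<Longrightarrow> p t - (\<Sum>i=0..r. q i t) > 0"
  shows "\<exists>lam K0. positively_regressive (T \<inter> {t0..}) lam \<and>
           (\<forall>t \<in> T \<inter> {t0..}. lam t < 0) \<and> K0 > 1 \<and>
           (\<forall>t \<in> T \<inter> {t0..}. x t \<le> K0 * delta_exp (T \<inter> {t0..}) lam t t0)"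
proof -
  define S where "S = T \<inter> {t0..}"
  note shifts = assms(4) and delays = assms(7)
  have t0: "t0 \<in> T" using shifts unfolding shift_operators_def by auto
  have q_nonneg: "0 \<le> q i t" if "i \<le> r" "t \<in> S" for i t
    using assms(17)[of i t] assms(18)[of t] that by (cases "i = r") (auto simp: S_def)
  have \<tau>: "\<delta>m (h i) t \<le> t \<and> \<delta>m (h i) t \<in> T" if "i \<le> r" "t \<in> S" for i t
  proof (cases "i = 0")
    case True
    then show ?thesis
      using shift_initial(2)[OF shifts, of t] \<open>h 0 = t0\<close> that(2) by (simp add: S_def)
  next
    case False
    with that(1) have "i \<in> {1..r}" by simp
    from delay_less[OF shifts delays[OF this]] delay_mem[OF shifts delays[OF this]] that(2)
    show ?thesis unfolding S_def by (meson less_imp_le)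
  qed
  have \<tau>_bdd: "bdd_above {t \<in> S. \<delta>m (h i) t \<le> s}" if "i \<le> r" for i s
  proof (cases "i = 0")
    case True
    then have "{t \<in> S. \<delta>m (h i) t \<le> s} \<subseteq> {..s}"
      using shift_initial(2)[OF shifts] \<open>h 0 = t0\<close> by (auto simp: S_def)
    then show ?thesis by (rule bdd_above_mono[rotated]) simp
  next
    case False
    then show ?thesis
      unfolding S_def using that by (intro delay_sublevel_bdd[OF shifts delays assms(2)]) auto
  qed
  have p_grain: "graininess S t * p t \<le> 1" if t: "t \<in> S" for t
  proof -
    have "\<delta>m (h r) t0 \<le> t" using \<tau>[of r t0] t t0 by (simp add: S_def)
    then have "graininess S t \<le> sup_graininess T (\<delta>m (h r) t0) t"
      using graininess_le_sup_graininess[of t T "\<delta>m (h r) t0"] t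
      by (auto simp: S_def graininess_def forward_jump_Int_atLeast)
    moreover have "0 \<le> (\<Sum>i=0..r. q i t)" using q_nonneg t by (intro sum_nonneg) auto
    then have "0 \<le> p t" using assms(19)[of t] t by (simp add: S_def)
    ultimately have "graininess S t * p t \<le> sup_graininess T (\<delta>m (h r) t0) t * p t"
      by (rule mult_right_mono)
    then show ?thesis using assms(16)[of t] t by (simp add: S_def)
  qed
  have S: "closed S" "\<not> bdd_above S" "t0 \<in> S" "S \<subseteq> {t0..}"
  proof -
    show "closed S" using assms(1) by (auto simp: S_def time_scale_def)
    show "\<not> bdd_above S"
    proof
      assume "bdd_above S"
      then obtain b where "\<And>t. t \<in> S \<Longrightarrow> t \<le> b" by (auto simp: bdd_above_def)
      then have "t \<le> max b t0" if "t \<in> T" for t using that by (force simp: S_def)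
      with assms(2) show False by (meson bdd_aboveI)
    qed
  qed (use t0 in \<open>auto simp: S_def\<close>)
  have "\<exists>lam K. positively_regressive S lam \<and> (\<forall>t\<in>S. lam t < 0) \<and> 1 < K \<and>
      (\<forall>t\<in>S. x t \<le> K * delta_exp S lam t t0)"
  proof (rule sublinear_delay_inequality_decay[OF S, of r "\<lambda>i. \<delta>m (h i)" l x x' p q])
    show "\<delta>m (h i) t \<in> S" if "i \<le> r" "t \<in> S" "t0 \<le> \<delta>m (h i) t" for i t
      using \<tau>[OF that(1,2)] that(3) by (simp add: S_def)
  qed (fact \<tau>[THEN conjunct1] \<tau>_bdd assms(8,9) assms(10-12,14,19)[folded S_def] p_grain q_nonneg)+
  then show ?thesis unfolding S_def .
qed

end
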